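(* Let $\mathbb{L}$ be a label space with given disjoint measurable subsets $\mathbb{L}^i$, $i\in N_v$, and let $\boldsymbol l(\cdot):[t_0,t_f]\to\mathbb{L}$, with $t_f-t_0>0$, be a nontrivial, continuous label space trajectory. Then $\boldsymbol l(\cdot)$ generates a control walk in the $\mathcal{T}$-graph of $(\mathbb{L},(\mathbb{L}^i)_{i\in N_v})$. That is, the segmentation $\langle\psi_0,\psi_1,\ldots,\psi_n\rangle$, $n\in\mathbb{N}$, of $\boldsymbol l(\cdot)$ is a control walk (possibly a trivial control walk) in the $\mathcal{T}$-graph.
   Context: Conventions: $\mathbb{N}=\{0,1,2,\ldots\}$ and $\mathbb{N}_+=\{1,2,\ldots\}$. A functional is a mapping from a space of measurable functions to $\mathbb{R}$; $\text{dom}(\cdot)$ denotes its domain. $\mathcal{F}$-graph: a finite collection of functionals that constitute the arcs (edges) $E^k$ and vertices $V^i$ of a graph. $\mathcal{F}$-control: a sequence of functions $\langle\psi_0,\psi_1,\ldots,\psi_n\rangle$, $n\in\mathbb{N}$, where each $\psi_j$ is selected from the domain of some $V^i$ or the domain of some $E^k$. Control walk: an $\mathcal{F}$-control such that $\psi_j\in\text{dom}(E^k)$ implies $\psi_{j-1}\in\text{dom}(V^l)$ and $\psi_{j+1}\in\text{dom}(V^m)$, where $E^k$ is the arc that joins $V^l$ to $V^m$ (the condition being imposed for indices $0<j<n$). Trivial control walk: the following short sequences are also control walks, called trivial: (1) $\langle\psi_0\rangle$ with $\psi_0\in\text{dom}(V^i)$ for some $i$; (2) $\langle\psi_0,\psi_1\rangle$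 with ($\psi_0\in\text{dom}(V^i)$ and $\psi_1\in\text{dom}(E^k)$) or ($\psi_0\in\text{dom}(E^k)$ and $\psi_1\in\text{dom}(V^i)$), for some $i,k$, where $E^k$ joins $V^i$ with itself or with some other vertex; (3) $\langle\psi_0,\psi_1,\psi_2\rangle$ with $\psi_0\in\text{dom}(E^k)$, $\psi_1\in\text{dom}(V^i)$, $\psi_2\in\text{dom}(E^m)$ for some $i,k,m$, where $E^k$ and $E^m$ join $V^i$ with itself or with some other vertex. Label space: a measure space $\mathbb{L}$ together with a given finite collection of disjoint measurable subsets $\mathbb{L}^i$, $i\in N_v=\{1,\ldots,|N_v|\}$, of $\mathbb{L}$. Put $\mathbb{L}^a:=\mathbb{L}\setminus\bigcup_{i\in N_v}\mathbb{L}^i$. So that continuity makes sense, $\mathbb{L}$ also carries a topology. $\mathcal{T}$-graph: the $\mathcal{F}$-graph with vertex functionals $V^i$, $i\in N_v$, and arc functionals $E^{l,m}=E^a$ joining $V^l$ to $V^m$ for all $l,m\in N_v$, where $\text{dom}(V^i)$ is the set of measurable functions from $\mathbb{R}$ to $\mathbb{L}^i$ and $\text{dom}(E^a)$ is the set of measurable functions from $\mathbb{R}$ to $\mathbb{L}^a$. Here functions may be defined only on a subinterval of $\mathbb{R}$, and membership of values in $\mathbb{L}^i$ or $\mathbb{L}^a$ is understood for almost all $t$ in that subinterval. Label space trajectory: a measurable function $\boldsymbol l(\cdot):[t_0,t_f]\to\mathbb{L}$ with $t_f-t_0>0$. It is trivial if its image is contained in $\mathbb{L}^a$, and nontrivial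 otherwise. Segmentation of a trajectory: given an increasing sequence $t_0<t_1<\cdots<t_n<t_{n+1}=t_f$, $n\in\mathbb{N}$, such that for each $j=0,\ldots,n$ the duration $t_{j+1}-t_j$ is maximal subject to: either there is $i\in N_v$ with $\boldsymbol l(t)\in\mathbb{L}^i$ for almost all $t\in(t_j,t_{j+1})$, or $\boldsymbol l(t)\in\mathbb{L}^a$ for almost all $t\in(t_j,t_{j+1})$; the segmentation is $\langle\psi_0,\ldots,\psi_n\rangle$ with $\psi_j:=\boldsymbol l(\cdot)|_{(t_j,t_{j+1})}$. *)

theory Defs
  imports "HOL-Analysis.Analysis"
begin

text \<open>
  Functions that are defined only on a subinterval of the reals are modelled as partial maps
  \<^typ>\<open>real \<rightharpoonup> 'l\<close>, and functionals as partial maps on such functions, so that \<^const>\<open>dom\<close> is the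
  domain in both cases. Subintervals are nondegenerate: on a null set every almost-everywhere
  condition would hold vacuously. Measurable means Lebesgue measurable.
\<close>

definition interval_functions :: "'l measure \<Rightarrow> (real \<rightharpoonup> 'l) set" where
  "interval_functions M =
    {f. is_interval (dom f) \<and> interior (dom f) \<noteq> {} \<and>
        (\<lambda>t. the (f t)) \<in> measurable (lebesgue_on (dom f)) M}"

definition interval_functions_into :: "'l measure \<Rightarrow> 'l set \<Rightarrow> (real \<rightharpoonup> 'l) set" where
  "interval_functions_into M A =
    {f \<in> interval_functions M. AE t in lebesgue_on (dom f). the (f t) \<in> A}"

type_synonym 'l functional = "(real \<rightharpoonup> 'l) \<rightharpoonup> real"

text \<open>
  A triple \<open>(l, E, m)\<close> in \<open>arcs\<close> says that the functional \<open>E\<close> joins vertex \<open>l\<close> to vertex \<open>m\<close>; one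
  functional may join several pairs of vertices.
\<close>

record ('v, 'l) functional_graph =
  verts :: "'v set"
  vfun :: "'v \<Rightarrow> 'l functional"
  arcs :: "('v \<times> 'l functional \<times> 'v) set"

definition F_graph :: "'l measure \<Rightarrow> ('v, 'l) functional_graph \<Rightarrow> bool" where
  "F_graph M G \<longleftrightarrow>
    finite (verts G) \<and> finite (arcs G) \<and>
    (\<forall>i\<in>verts G. dom (vfun G i) \<subseteq> interval_functions M) \<and>
    (\<forall>(l, E, m)\<in>arcs G. l \<in> verts G \<and> m \<in> verts G \<and> dom E \<subseteq> interval_functions M)"

definition arc_functionals :: "('v, 'l) functional_graph \<Rightarrow> 'l functional set" where
  "arc_functionals G = {E. \<exists>l m. (l, E, m) \<in> arcs G}"

definition incident :: "('v, 'l) functional_graph \<Rightarrow> 'l functional \<Rightarrow> 'v \<Rightarrow> bool" where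
  "incident G E i \<longleftrightarrow> (\<exists>m. (i, E, m) \<in> arcs G \<or> (m, E, i) \<in> arcs G)"

definition F_control :: "('v, 'l) functional_graph \<Rightarrow> (real \<rightharpoonup> 'l) list \<Rightarrow> bool" where
  "F_control G \<psi> \<longleftrightarrow> \<psi> \<noteq> [] \<and>
    (\<forall>f\<in>set \<psi>. (\<exists>i\<in>verts G. f \<in> dom (vfun G i)) \<or> (\<exists>E\<in>arc_functionals G. f \<in> dom E))"

definition trivial_control_walk :: "('v, 'l) functional_graph \<Rightarrow> (real \<rightharpoonup> 'l) list \<Rightarrow> bool" where
  "trivial_control_walk G \<psi> \<longleftrightarrow>
    (\<exists>f. \<psi> = [f] \<and> (\<exists>i\<in>verts G. f \<in> dom (vfun G i))) \<or>
    (\<exists>f g. \<psi> = [f, g] \<and>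
      (\<exists>i\<in>verts G. \<exists>E. incident G E i \<and>
        (f \<in> dom (vfun G i) \<and> g \<in> dom E \<or> f \<in> dom E \<and> g \<in> dom (vfun G i)))) \<or>
    (\<exists>f g h. \<psi> = [f, g, h] \<and>
      (\<exists>i\<in>verts G. \<exists>E E'. incident G E i \<and> incident G E' i \<and>
        f \<in> dom E \<and> g \<in> dom (vfun G i) \<and> h \<in> dom E'))"

text \<open>For \<open>\<psi> = \<langle>\<psi>\<^sub>0, \<dots>, \<psi>\<^sub>n\<rangle>\<close> the bound \<open>Suc j < length \<psi>\<close> is \<open>j < n\<close>.\<close>

definition control_walk :: "('v, 'l) functional_graph \<Rightarrow> (real \<rightharpoonup> 'l) list \<Rightarrow> bool" where
  "control_walk G \<psi> \<longleftrightarrow>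
    (F_control G \<psi> \<and>
      (\<forall>j. 0 < j \<and> Suc j < length \<psi> \<longrightarrow>
        (\<forall>E\<in>arc_functionals G. \<psi> ! j \<in> dom E \<longrightarrow>
          (\<exists>l m. (l, E, m) \<in> arcs G \<and>
            \<psi> ! (j - 1) \<in> dom (vfun G l) \<and> \<psi> ! (j + 1) \<in> dom (vfun G m))))) \<or>
    trivial_control_walk G \<psi>"

text \<open>
  No compatibility between the sigma-algebra and the topology is required beyond having the same
  carrier.
\<close>

definition label_space :: "'l measure \<Rightarrow> 'l topology \<Rightarrow> nat \<Rightarrow> (nat \<Rightarrow> 'l set) \<Rightarrow> bool" where
  "label_space M T N L \<longleftrightarrow>
    topspace T = space M \<and> (\<forall>i\<in>{1..N}. L i \<in> sets M) \<and> disjoint_family_on L {1..N}"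

definition arc_labels :: "'l measure \<Rightarrow> nat \<Rightarrow> (nat \<Rightarrow> 'l set) \<Rightarrow> 'l set" where
  "arc_labels M N L = space M - (\<Union>i\<in>{1..N}. L i)"

text \<open>Only the domains of the functionals are prescribed; their values are arbitrary.\<close>

definition T_graph ::
    "'l measure \<Rightarrow> nat \<Rightarrow> (nat \<Rightarrow> 'l set) \<Rightarrow> (nat, 'l) functional_graph \<Rightarrow> bool" where
  "T_graph M N L G \<longleftrightarrow>
    verts G = {1..N} \<and>
    (\<forall>i\<in>{1..N}. dom (vfun G i) = interval_functions_into M (L i)) \<and>
    (\<exists>E. dom E = interval_functions_into M (arc_labels M N L) \<and>
         arcs G = {(l, E, m) |l m. l \<in> {1..N} \<and> m \<in> {1..N}})"

lemma T_graph_imp_F_graph: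
  assumes "T_graph M N L G"
  shows "F_graph M G"
proof -
  obtain E where E: "dom E = interval_functions_into M (arc_labels M N L)"
    and arcs: "arcs G = {(l, E, m) |l m. l \<in> {1..N} \<and> m \<in> {1..N}}"
    using assms unfolding T_graph_def by blast
  have "arcs G = (\<lambda>(l, m). (l, E, m)) ` ({1..N} \<times> {1..N})"
    unfolding arcs by auto
  then have "finite (arcs G)"
    by simp
  then show ?thesis
    using assms arcs E
    unfolding F_graph_def T_graph_def interval_functions_into_def by auto
qed

definition label_trajectory ::
    "'l measure \<Rightarrow> real \<Rightarrow> real \<Rightarrow> (real \<rightharpoonup> 'l) \<Rightarrow> bool" where
  "label_trajectory M t\<^sub>0 t\<^sub>f l \<longleftrightarrow>
    t\<^sub>f - t\<^sub>0 > 0 \<and> dom l = {t\<^sub>0..t\<^sub>f} \<and> l \<in> interval_functions M"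

definition trivial_trajectory ::
    "'l measure \<Rightarrow> nat \<Rightarrow> (nat \<Rightarrow> 'l set) \<Rightarrow> (real \<rightharpoonup> 'l) \<Rightarrow> bool" where
  "trivial_trajectory M N L l \<longleftrightarrow> ran l \<subseteq> arc_labels M N L"

definition continuous_trajectory :: "'l topology \<Rightarrow> (real \<rightharpoonup> 'l) \<Rightarrow> bool" where
  "continuous_trajectory T l \<longleftrightarrow> continuous_map (top_of_set (dom l)) T (\<lambda>t. the (l t))"

definition uniform_label ::
    "'l measure \<Rightarrow> nat \<Rightarrow> (nat \<Rightarrow> 'l set) \<Rightarrow> (real \<rightharpoonup> 'l) \<Rightarrow> real \<Rightarrow> real \<Rightarrow> bool" where
  "uniform_label M N L l a b \<longleftrightarrow>
    (\<exists>i\<in>{1..N}. AE t in lebesgue_on {a<..<b}. the (l t) \<in> L i) \<or>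
    (AE t in lebesgue_on {a<..<b}. the (l t) \<in> arc_labels M N L)"

text \<open>
  Maximality of the duration is meant with the left end point \<open>t j\<close> fixed. Since the label sets are
  disjoint, the segments of such a sequence cannot be extended to the left either.
\<close>

definition segmentation ::
    "'l measure \<Rightarrow> nat \<Rightarrow> (nat \<Rightarrow> 'l set) \<Rightarrow> real \<Rightarrow> real \<Rightarrow> (real \<rightharpoonup> 'l) \<Rightarrow>
      (real \<rightharpoonup> 'l) list \<Rightarrow> bool" where
  "segmentation M N L t\<^sub>0 t\<^sub>f l \<psi> \<longleftrightarrow>
    (\<exists>(n::nat) (t::nat \<Rightarrow> real).
      t 0 = t\<^sub>0 \<and> t (n + 1) = t\<^sub>f \<and>
      (\<forall>j\<le>n. t j < t (j + 1) \<and>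
        uniform_label M N L l (t j) (t (j + 1)) \<and>
        (\<forall>s. t j < s \<and> s \<le> t\<^sub>f \<and> uniform_label M N L l (t j) s \<longrightarrow>
          s - t j \<le> t (j + 1) - t j)) \<and>
      \<psi> = map (\<lambda>j. l |` {t j<..<t (j + 1)}) [0..<n + 1])"

end

theory Submission
  imports Defs
begin

text \<open>
  Two consecutive segments cannot both run in \<^term>\<open>arc_labels M N L\<close>: their union, which misses
  only one point, would be a longer segment starting at the same left end point. Hence every
  neighbour of an arc segment is a vertex segment, and since an arc joins every pair of vertices
  nothing else has to be checked. Nontriviality supplies at least one vertex, without which there
  would be no arcs at all.
\<close>

text \<open>Wherever \<open>b\<close> lies, each point of \<open>{a<..<c}\<close> other than
  \<open>b\<close> is in one of the two given intervals, and \<open>{b}\<close> is a null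
  set.\<close>

lemma AE_lebesgue_on_Ioo_join:
  fixes a b c :: real
  assumes "AE t in lebesgue_on {a<..<b}. P t" and "AE t in lebesgue_on {b<..<c}. P t"
  shows "AE t in lebesgue_on {a<..<c}. P t"
proof -
  have "AE t in lebesgue. t \<noteq> b"
    by (rule AE_I'[of "{b}"]) (auto intro: null_sets_completionI)
  moreover have "AE t in lebesgue. t \<in> {a<..<b} \<longrightarrow> P t" "AE t in lebesgue. t \<in> {b<..<c} \<longrightarrow> P t"
    using assms by (simp_all add: AE_restrict_space_iff)
  ultimately have "AE t in lebesgue. t \<in> {a<..<c} \<longrightarrow> P t"
    by eventually_elim auto
  then show ?thesis
    by (simp add: AE_restrict_space_iff)
qed

lemma interval_functions_restrict:
  assumes "l \<in> interval_functions M" and "{a<..<b} \<subseteq> dom l" and "a < b"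
  shows "l |` {a<..<b} \<in> interval_functions M"
proof -
  have dom: "dom (l |` {a<..<b}) = {a<..<b}"
    using assms(2) by auto
  have "(\<lambda>t. the (l t)) \<in> measurable (lebesgue_on {a<..<b}) M"
    using assms by (auto simp: interval_functions_def intro: measurable_restrict_mono)
  then have "(\<lambda>t. the ((l |` {a<..<b}) t)) \<in> measurable (lebesgue_on {a<..<b}) M"
    by (rule measurable_cong[THEN iffD1, rotated]) simp
  then show ?thesis
    \<comment> \<open>\<open>a < b\<close> gives the open interval a nonempty interior.\<close>
    using assms(3) unfolding interval_functions_def mem_Collect_eq dom by (simp add: is_interval_oo)
qed

text \<open>Turns membership of a segment in the domain of a functional into an almost-everywhere
  condition on the trajectory itself, the form that \<open>uniform_label\<close> uses and that can
  be glued across a break point.\<close>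

lemma interval_functions_into_restrict_iff:
  assumes "l \<in> interval_functions M" and "{a<..<b} \<subseteq> dom l" and "a < b"
  shows "l |` {a<..<b} \<in> interval_functions_into M A \<longleftrightarrow>
    (AE t in lebesgue_on {a<..<b}. the (l t) \<in> A)"
proof -
  have dom: "dom (l |` {a<..<b}) = {a<..<b}"
    using assms(2) by auto
  have "(AE t in lebesgue_on {a<..<b}. the ((l |` {a<..<b}) t) \<in> A) \<longleftrightarrow>
    (AE t in lebesgue_on {a<..<b}. the (l t) \<in> A)"
    by (rule AE_cong) simp
  then show ?thesis
    using interval_functions_restrict[OF assms]
    unfolding interval_functions_into_def mem_Collect_eq dom by blast
qed

text \<open>For \<open>N = 0\<close> the union of the label sets is empty, so every point of
  \<open>space M\<close> is an arc label; a measurable trajectory takes its values there and would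
  be trivial.\<close>

lemma nontrivial_trajectory_imp_vertex:
  assumes "l \<in> interval_functions M" and "\<not> trivial_trajectory M N L l"
  shows "1 \<le> N"
proof (rule ccontr)
  assume "\<not> 1 \<le> N"
  then have "arc_labels M N L = space M"
    by (simp add: arc_labels_def)
  moreover have "ran l \<subseteq> space M"
  proof
    fix x assume "x \<in> ran l"
    then obtain t where "l t = Some x"
      by (auto simp: ran_def)
    then have "t \<in> space (lebesgue_on (dom l))" and "the (l t) = x"
      by auto
    moreover have "(\<lambda>t. the (l t)) \<in> measurable (lebesgue_on (dom l)) M"
      using assms(1) by (simp add: interval_functions_def)
    ultimately show "x \<in> space M"
      by (metis measurable_space)
  qed
  ultimately show False
    using assms(2) by (simp add: trivial_trajectory_def)
qed

theorem theorem1: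
  fixes M :: "'l measure" and T :: "'l topology" and N :: nat and L :: "nat \<Rightarrow> 'l set"
    and G :: "(nat, 'l) functional_graph"
    and t\<^sub>0 t\<^sub>f :: real and l :: "real \<rightharpoonup> 'l" and \<psi> :: "(real \<rightharpoonup> 'l) list"
  assumes "label_space M T N L"
    and "T_graph M N L G"
    and "label_trajectory M t\<^sub>0 t\<^sub>f l"
    and "\<not> trivial_trajectory M N L l"
    and "continuous_trajectory T l"
    and "segmentation M N L t\<^sub>0 t\<^sub>f l \<psi>"
  shows "control_walk G \<psi>"
proof -
  have l: "l \<in> interval_functions M" and dom_l: "dom l = {t\<^sub>0..t\<^sub>f}"
    using assms(3) by (auto simp: label_trajectory_def)
  have N: "1 \<le> N"
    using nontrivial_trajectory_imp_vertex l assms(4) .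
  have verts: "verts G = {1..N}"
    and vfun: "\<And>i. i \<in> {1..N} \<Longrightarrow> dom (vfun G i) = interval_functions_into M (L i)"
    using assms(2) by (auto simp: T_graph_def)
  obtain E where E: "dom E = interval_functions_into M (arc_labels M N L)"
    and arcs: "arcs G = {(l, E, m) |l m. l \<in> {1..N} \<and> m \<in> {1..N}}"
    using assms(2) unfolding T_graph_def by blast
  \<comment> \<open>Since \<open>1 \<le> N\<close>, the loop \<open>(1, E, 1)\<close> is an arc, so
    \<open>E\<close> does occur as an arc functional.\<close>
  have arc_fun: "arc_functionals G = {E}"
    using N unfolding arc_functionals_def arcs by auto
  obtain n t where t0: "t 0 = t\<^sub>0" and tf: "t (n + 1) = t\<^sub>f"
    and less: "\<And>j. j \<le> n \<Longrightarrow> t j < t (j + 1)"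
    and uniform: "\<And>j. j \<le> n \<Longrightarrow> uniform_label M N L l (t j) (t (j + 1))"
    and maximal: "\<And>j s. \<lbrakk>j \<le> n; t j < s; s \<le> t\<^sub>f; uniform_label M N L l (t j) s\<rbrakk>
                    \<Longrightarrow> s - t j \<le> t (j + 1) - t j"
    and psi: "\<psi> = map (\<lambda>j. l |` {t j<..<t (j + 1)}) [0..<n + 1]"
    using assms(6) unfolding segmentation_def by blast
  have lower: "t\<^sub>0 \<le> t j" if "j \<le> n + 1" for j
    using that
  proof (induction j)
    case (Suc j)
    then show ?case
      using less[of j] by simp
  qed (simp add: t0)
  \<comment> \<open>Downward induction from \<open>n + 1\<close>, where the break point is
    \<open>t\<^sub>f\<close>.\<close>
  have upper: "t j \<le> t\<^sub>f" if "j \<le> n + 1" for j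
    using that
  proof (induction rule: inc_induct)
    case (step j)
    then show ?case
      using less[of j] by simp
  qed (use tf in simp)
  have sub: "{t j<..<t (j + 1)} \<subseteq> dom l" if "j \<le> n" for j
    using lower[of j] upper[of "j + 1"] that by (auto simp: dom_l)
  have nth: "\<psi> ! j = l |` {t j<..<t (j + 1)}" if "j \<le> n" for j
    using that unfolding psi by (subst nth_map) (auto simp del: upt_Suc)
  have length: "length \<psi> = n + 1"
    by (simp add: psi)
  have psi_iff: "\<psi> ! j \<in> interval_functions_into M A \<longleftrightarrow>
      (AE u in lebesgue_on {t j<..<t (j + 1)}. the (l u) \<in> A)" if "j \<le> n" for j A
    using interval_functions_into_restrict_iff[OF l sub less] that by (simp add: nth)
  \<comment> \<open>Reading \<open>psi_iff\<close> from right to left makes the two alternatives of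
    \<open>uniform_label\<close> the domains of the vertex functionals and of
    \<open>E\<close>.\<close>
  have cases: "(\<exists>i\<in>{1..N}. \<psi> ! j \<in> dom (vfun G i)) \<or> \<psi> ! j \<in> dom E" if "j \<le> n" for j
    using uniform[OF that] vfun E
    unfolding uniform_label_def psi_iff[OF that, symmetric] by blast
  have no_consecutive_arcs: "\<not> (\<psi> ! j \<in> dom E \<and> \<psi> ! (j + 1) \<in> dom E)" if "j + 1 \<le> n" for j
  proof
    assume "\<psi> ! j \<in> dom E \<and> \<psi> ! (j + 1) \<in> dom E"
    then have "AE u in lebesgue_on {t j<..<t (j + 1)}. the (l u) \<in> arc_labels M N L"
      and "AE u in lebesgue_on {t (j + 1)<..<t (j + 1 + 1)}. the (l u) \<in> arc_labels M N L"
      using that psi_iff[of j] psi_iff[of "j + 1"] by (simp_all add: E)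
    then have "AE u in lebesgue_on {t j<..<t (j + 1 + 1)}. the (l u) \<in> arc_labels M N L"
      by (rule AE_lebesgue_on_Ioo_join)
    then have "uniform_label M N L l (t j) (t (j + 1 + 1))"
      unfolding uniform_label_def by blast
    moreover have "t j < t (j + 1)" and "t (j + 1) < t (j + 1 + 1)" and "t (j + 1 + 1) \<le> t\<^sub>f"
      using that by (intro less upper; simp)+
    \<comment> \<open>The competing right end \<open>s\<close> in \<open>maximal\<close> is the end
      of the next segment, which \<open>upper\<close> keeps within \<open>t\<^sub>f\<close>.\<close>
    ultimately show False
      using maximal[of j "t (j + 1 + 1)"] that by linarith
  qed
  have "F_control G \<psi>"
    unfolding F_control_def
  proof (intro conjI ballI)
    show "\<psi> \<noteq> []"
      using length by auto
    fix f assume "f \<in> set \<psi>"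
    then obtain j where "j \<le> n" "f = \<psi> ! j"
      unfolding in_set_conv_nth length by (metis less_Suc_eq_le Suc_eq_plus1)
    then show "(\<exists>i\<in>verts G. f \<in> dom (vfun G i)) \<or> (\<exists>E\<in>arc_functionals G. f \<in> dom E)"
      using cases[of j] unfolding verts arc_fun by blast
  qed
  \<comment> \<open>The nontrivial clause of \<open>control_walk\<close> is shown for every length;
    with at most two segments no \<open>j\<close> is interior and it holds vacuously.\<close>
  moreover have "\<exists>l m. (l, E, m) \<in> arcs G \<and>
      \<psi> ! (j - 1) \<in> dom (vfun G l) \<and> \<psi> ! (j + 1) \<in> dom (vfun G m)"
    if j: "0 < j" "Suc j < length \<psi>" and "\<psi> ! j \<in> dom E" for j
  proof -
    \<comment> \<open>Because \<open>0 < j\<close>, the natural subtraction is exact, so consecutive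
      pairs starting at \<open>j - 1\<close> and at \<open>j\<close> cover both neighbours.\<close>
    have le: "j - 1 \<le> n" "j - 1 + 1 \<le> n" "j + 1 \<le> n" and "j - 1 + 1 = j"
      using j length by linarith+
    then have "\<psi> ! (j - 1) \<notin> dom E" and "\<psi> ! (j + 1) \<notin> dom E"
      using no_consecutive_arcs[of "j - 1"] no_consecutive_arcs[of j] \<open>\<psi> ! j \<in> dom E\<close> by metis+
    then obtain i k where "i \<in> {1..N}" "\<psi> ! (j - 1) \<in> dom (vfun G i)"
      and "k \<in> {1..N}" "\<psi> ! (j + 1) \<in> dom (vfun G k)"
      using cases[OF le(1)] cases[OF le(3)] by blast
    \<comment> \<open>The arc is \<open>(i, E, k)\<close>; loops belong to \<open>arcs G\<close>, so
      \<open>i = k\<close> is covered.\<close>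
    then show ?thesis
      unfolding arcs by blast
  qed
  ultimately show ?thesis
    unfolding control_walk_def arc_fun by blast
qed

end
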